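(* Let $G=\mathrm{Isom}_e\mathrm{Sol}=\mathrm{Sol}$, let $M$ be a connected closed oriented $3$-manifold, and let $\rho\colon\pi_1(M)\to G$ be a representation. For any section $s\colon M\to P_\rho$, any flat connection $\omega_{\mathrm{flat}}$ on $P_\rho$, and the invariant polynomial $p=p_c$ with any $c\in\mathbb R$, we have $$\mathrm{CS}_p(\omega_{\mathrm{flat}},\omega_{\mathrm{triv}}^s)=0.$$
   Context: Manifolds, bundles and maps are smooth. $P_\rho=\widetilde M\times_\rho G$ is the flat principal bundle of $\rho$. $\omega_{\mathrm{triv}}^s$ is the unique flat connection with $s^*\omega_{\mathrm{triv}}^s=0$. $\mathrm{Sol}=\mathbb R^3$, $(x,y,z)$ corresponding to $\begin{pmatrix}e^{-z}&0&x\\0&e^z&y\\0&0&1\end{pmatrix}$ under matrix multiplication; $\mathfrak g=\mathrm{Lie}(G)$ has basis $X,Y,Z$ (the left-invariant frame $e^{-z}\partial_x,e^z\partial_y,\partial_z$) with nontrivial brackets $[X,Z]=X$, $[Y,Z]=-Y$. $p_c=\langle\cdot,\cdot\rangle$ is the $\mathrm{Ad}(G)$-invariant symmetric bilinear form whose only possibly nonzero component is $\langle Z,Z\rangle=c$. For $\mathfrak g$-valued forms, $[\alpha\otimes\xi,\beta\otimes\eta]=(\alpha\wedge\beta)\otimes[\xi,\eta]$ and $\langle\alpha\otimes\xi,\beta\otimes\eta\rangle=(\alpha\wedge\beta)\langle\xi,\eta\rangle$. For connections $\omega_1,\omega_0$ with $a=\omega_1-\omega_0$ (an $\mathrm{ad}P$-valued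 $1$-form on $M$), $\Omega_0=d\omega_0+\frac12[\omega_0,\omega_0]$, $d_{\omega_0}a=da+[\omega_0,a]$, the relative Chern--Simons form is $\mathrm{CS}_p(\omega_1,\omega_0)=\langle a,d_{\omega_0}a\rangle+\frac13\langle a,[a,a]\rangle+2\langle a,\Omega_0\rangle$, a real $3$-form on $M$. *)

theory Defs
  imports "HOL-Analysis.Analysis" "HOL-Algebra.Group"
begin

section \<open>Smooth manifolds given by atlases\<close>

type_synonym ('a, 'e) chart = "'a set \<times> ('a \<Rightarrow> 'e)"
type_synonym ('a, 'e) atlas = "('a, 'e) chart set"

primrec Ck_on :: "nat \<Rightarrow> 'a::euclidean_space set \<Rightarrow> ('a \<Rightarrow> 'b::real_normed_vector) \<Rightarrow> bool" where
  "Ck_on 0 S f \<longleftrightarrow> continuous_on S f"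
| "Ck_on (Suc k) S f \<longleftrightarrow>
     (\<forall>x\<in>S. f differentiable (at x)) \<and> (\<forall>v. Ck_on k S (\<lambda>x. frechet_derivative f (at x) v))"

text \<open>Only used for open \<open>S\<close>.\<close>

definition smooth_on :: "'a::euclidean_space set \<Rightarrow> ('a \<Rightarrow> 'b::real_normed_vector) \<Rightarrow> bool" where
  "smooth_on S f \<longleftrightarrow> (\<forall>k. Ck_on k S f)"

definition atlas_carrier :: "('a, 'e) atlas \<Rightarrow> 'a set" where
  "atlas_carrier A = (\<Union>(U, c)\<in>A. U)"

text \<open>Smooth atlases (without boundary, of dimension \<open>DIM('e)\<close>) on a whole topological space. A smooth
  manifold is a Hausdorff second countable space, i.e. a type of class \<open>t2_space\<close> and
  \<open>second_countable_topology\<close>, with such an atlas.\<close>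

definition smooth_atlas :: "('a::topological_space, 'e::euclidean_space) atlas \<Rightarrow> bool" where
  "smooth_atlas A \<longleftrightarrow>
     atlas_carrier A = UNIV \<and>
     (\<forall>(U, c)\<in>A. open U \<and> open (c ` U) \<and> homeomorphism U (c ` U) c (inv_into U c)) \<and>
     (\<forall>(U, c)\<in>A. \<forall>(V, d)\<in>A. smooth_on (c ` (U \<inter> V)) (d \<circ> inv_into U c))"

text \<open>An orientation is given by an atlas whose transition maps preserve the orientation
  of \<open>real ^ 'n\<close>.\<close>

definition oriented_atlas :: "('a, real ^ 'n::finite) atlas \<Rightarrow> bool" where
  "oriented_atlas A \<longleftrightarrow>
     (\<forall>(U, c)\<in>A. \<forall>(V, d)\<in>A. \<forall>y\<in>c ` (U \<inter> V).
        det (matrix (frechet_derivative (d \<circ> inv_into U c) (at y))) > 0)"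

definition model_atlas :: "('e::euclidean_space, 'e) atlas" where
  "model_atlas = {(UNIV, id)}"

definition product_atlas ::
    "('a, 'e) atlas \<Rightarrow> ('b, 'f) atlas \<Rightarrow> ('a \<times> 'b, 'e \<times> 'f) atlas" where
  "product_atlas A B = {(U \<times> V, map_prod c d) | U c V d. (U, c) \<in> A \<and> (V, d) \<in> B}"

text \<open>The openness condition is continuity of \<open>f\<close> for the topologies induced by the atlases.\<close>

definition smooth_map ::
    "('a, 'e::euclidean_space) atlas \<Rightarrow> ('b, 'f::euclidean_space) atlas \<Rightarrow> ('a \<Rightarrow> 'b) \<Rightarrow> bool" where
  "smooth_map A B f \<longleftrightarrow>
     f ` atlas_carrier A \<subseteq> atlas_carrier B \<and>
     (\<forall>(U, c)\<in>A. \<forall>(V, d)\<in>B.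
        open (c ` (U \<inter> f -` V)) \<and> smooth_on (c ` (U \<inter> f -` V)) (d \<circ> f \<circ> inv_into U c))"

subsection \<open>Tangent maps\<close>

text \<open>Each point \<open>p\<close> gets a preferred chart, and the tangent space at \<open>p\<close> is identified with the model
  space \<open>'e\<close> through that chart. So a tangent vector at \<open>p\<close> is an element of \<open>'e\<close>, and
  \<open>tangent_map A B f p\<close> is the differential of \<open>f\<close> at \<open>p\<close>, written in the preferred charts at
  \<open>p\<close> and \<open>f p\<close>.\<close>

definition chart_at :: "('a, 'e) atlas \<Rightarrow> 'a \<Rightarrow> ('a, 'e) chart" where
  "chart_at A p = (SOME \<kappa>. \<kappa> \<in> A \<and> p \<in> fst \<kappa>)"

definition tangent_map ::
    "('a, 'e::euclidean_space) atlas \<Rightarrow> ('b, 'f::euclidean_space) atlas \<Rightarrow> ('a \<Rightarrow> 'b) \<Rightarrow> 'a \<Rightarrow> 'e \<Rightarrow> 'f"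
  where
  "tangent_map A B f p =
     (let (U, c) = chart_at A p; (V, d) = chart_at B (f p)
      in frechet_derivative (d \<circ> f \<circ> inv_into U c) (at (c p)))"

subsection \<open>Vector-valued differential forms\<close>

text \<open>A \<open>1\<close>-form on the manifold \<open>A\<close> takes a point and a tangent vector at that point. Values at
  points outside \<open>atlas_carrier A\<close> are irrelevant. Likewise for forms of degree \<open>2\<close> and \<open>3\<close>.\<close>

type_synonym ('a, 'e, 'v) form1 = "'a \<Rightarrow> 'e \<Rightarrow> 'v"
type_synonym ('a, 'e, 'v) form2 = "'a \<Rightarrow> 'e \<Rightarrow> 'e \<Rightarrow> 'v"
type_synonym ('a, 'e, 'v) form3 = "'a \<Rightarrow> 'e \<Rightarrow> 'e \<Rightarrow> 'e \<Rightarrow> 'v"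

definition pullback1 ::
    "('a, 'e::euclidean_space) atlas \<Rightarrow> ('b, 'f::euclidean_space) atlas \<Rightarrow> ('a \<Rightarrow> 'b)
       \<Rightarrow> ('b, 'f, 'v) form1 \<Rightarrow> ('a, 'e, 'v) form1" where
  "pullback1 A B f \<omega> p v = \<omega> (f p) (tangent_map A B f p v)"

text \<open>The coordinate expression, on \<open>c ` U \<subseteq> 'e\<close>, of a \<open>1\<close>-form in a chart \<open>(U, c)\<close>.\<close>

definition chart_rep ::
    "('a, 'e::euclidean_space) atlas \<Rightarrow> ('a, 'e) chart \<Rightarrow> ('a, 'e, 'v) form1 \<Rightarrow> ('e, 'e, 'v) form1" where
  "chart_rep A \<kappa> \<omega> = pullback1 model_atlas A (inv_into (fst \<kappa>) (snd \<kappa>)) \<omega>"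

definition smooth_form1 ::
    "('a, 'e::euclidean_space) atlas \<Rightarrow> ('a, 'e, 'v::real_normed_vector) form1 \<Rightarrow> bool" where
  "smooth_form1 A \<omega> \<longleftrightarrow>
     (\<forall>p\<in>atlas_carrier A. linear (\<omega> p)) \<and>
     (\<forall>(U, c)\<in>A. \<forall>v. smooth_on (c ` U) (\<lambda>y. chart_rep A (U, c) \<omega> y v))"

definition ext_deriv ::
    "('a, 'e::euclidean_space) atlas \<Rightarrow> ('a, 'e, 'v::real_normed_vector) form1 \<Rightarrow> ('a, 'e, 'v) form2" where
  "ext_deriv A \<omega> p u v =
     (let \<kappa> = chart_at A p; \<theta> = chart_rep A \<kappa> \<omega>; y = snd \<kappa> p
      in frechet_derivative (\<lambda>y. \<theta> y v) (at y) u - frechet_derivative (\<lambda>y. \<theta> y u) (at y) v)"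

text \<open>For a bilinear map \<open>B\<close>, the products determined by
  \<open>(\<alpha> \<otimes> \<xi>, \<beta> \<otimes> \<eta>) \<mapsto> (\<alpha> \<and> \<beta>) B(\<xi>, \<eta>)\<close>; here \<open>(\<alpha> \<and> \<beta>)(u, v) = \<alpha>(u)\<beta>(v) - \<alpha>(v)\<beta>(u)\<close>,
  with no factorial factors, as in \<^const>\<open>ext_deriv\<close>.\<close>

definition wedge11 ::
    "('v \<Rightarrow> 'v \<Rightarrow> 'w::ab_group_add) \<Rightarrow> ('a, 'e, 'v) form1 \<Rightarrow> ('a, 'e, 'v) form1 \<Rightarrow> ('a, 'e, 'w) form2" where
  "wedge11 B \<alpha> \<beta> p u v = B (\<alpha> p u) (\<beta> p v) - B (\<alpha> p v) (\<beta> p u)"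

definition wedge12 ::
    "('v \<Rightarrow> 'v \<Rightarrow> 'w::ab_group_add) \<Rightarrow> ('a, 'e, 'v) form1 \<Rightarrow> ('a, 'e, 'v) form2 \<Rightarrow> ('a, 'e, 'w) form3" where
  "wedge12 B \<alpha> \<beta> p u v w =
     B (\<alpha> p u) (\<beta> p v w) - B (\<alpha> p v) (\<beta> p u w) + B (\<alpha> p w) (\<beta> p u v)"

section \<open>The group Sol and its Lie algebra\<close>

definition sol_matrix :: "real^3 \<Rightarrow> real^3^3" where
  "sol_matrix g = vector [vector [exp (- (g$3)), 0, g$1], vector [0, exp (g$3), g$2], vector [0, 0, 1]]"

definition Sol :: "(real^3) monoid" where
  "Sol = \<lparr>carrier = UNIV,
          mult = (\<lambda>g h. vector [exp (- (g$3)) * h$1 + g$1, exp (g$3) * h$2 + g$2, g$3 + h$3]),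
          one = 0\<rparr>"

lemma sol_matrix_mult: "sol_matrix (g \<otimes>\<^bsub>Sol\<^esub> h) = sol_matrix g ** sol_matrix h"
  by (simp add: sol_matrix_def Sol_def matrix_matrix_mult_def vec_eq_iff forall_3 sum_3
      vector_3 exp_add exp_diff exp_minus field_simps)

lemma sol_matrix_one: "sol_matrix \<one>\<^bsub>Sol\<^esub> = mat 1"
  by (simp add: sol_matrix_def Sol_def mat_def vec_eq_iff forall_3 vector_3)

lemma group_Sol: "group Sol"
proof (rule groupI)
  fix g :: "real^3"
  show "\<exists>h\<in>carrier Sol. h \<otimes>\<^bsub>Sol\<^esub> g = \<one>\<^bsub>Sol\<^esub>"
    by (rule bexI[of _ "vector [- exp (g$3) * g$1, - exp (- (g$3)) * g$2, - (g$3)]"])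
       (simp_all add: Sol_def vec_eq_iff forall_3 vector_3)
qed (simp_all add: Sol_def vec_eq_iff forall_3 vector_3 exp_add exp_diff exp_minus field_simps)

text \<open>The Lie algebra is the tangent space at the unit; \<open>\<xi> :: real^3\<close> stands for
  \<open>\<xi>$1 X + \<xi>$2 Y + \<xi>$3 Z\<close>. This uses that the left-invariant frame \<open>X, Y, Z\<close> is the coordinate
  frame at the unit \<open>0\<close>.\<close>

definition sol_bracket :: "real^3 \<Rightarrow> real^3 \<Rightarrow> real^3" where
  "sol_bracket \<xi> \<eta> = vector [\<xi>$1 * \<eta>$3 - \<xi>$3 * \<eta>$1, - (\<xi>$2 * \<eta>$3 - \<xi>$3 * \<eta>$2), 0]"

definition sol_Ad :: "real^3 \<Rightarrow> real^3 \<Rightarrow> real^3" where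
  "sol_Ad g = frechet_derivative (\<lambda>h. g \<otimes>\<^bsub>Sol\<^esub> h \<otimes>\<^bsub>Sol\<^esub> inv\<^bsub>Sol\<^esub> g) (at \<one>\<^bsub>Sol\<^esub>)"

definition sol_form :: "real \<Rightarrow> real^3 \<Rightarrow> real^3 \<Rightarrow> real" where
  "sol_form c \<xi> \<eta> = c * \<xi>$3 * \<eta>$3"

section \<open>Fundamental group, universal cover and flat bundle\<close>

definition homotopy_class :: "(real \<Rightarrow> 'm::topological_space) \<Rightarrow> (real \<Rightarrow> 'm) set" where
  "homotopy_class \<alpha> = {\<beta>. homotopic_paths UNIV \<alpha> \<beta>}"

definition join_class ::
    "(real \<Rightarrow> 'm::topological_space) set \<Rightarrow> (real \<Rightarrow> 'm) set \<Rightarrow> (real \<Rightarrow> 'm) set" where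
  "join_class a b = (\<Union>\<alpha>\<in>a. \<Union>\<beta>\<in>b. homotopy_class (\<alpha> +++ \<beta>))"

definition pi1 :: "'m::topological_space \<Rightarrow> (real \<Rightarrow> 'm) set monoid" where
  "pi1 x0 = \<lparr>carrier = {homotopy_class \<gamma> | \<gamma>. path \<gamma> \<and> pathstart \<gamma> = x0 \<and> pathfinish \<gamma> = x0},
             mult = join_class,
             one = homotopy_class (\<lambda>_. x0)\<rparr>"

text \<open>The universal cover of a connected manifold: homotopy classes of paths issuing from \<open>x0\<close>,
  projected to their end points. The group \<open>pi1 x0\<close> acts on the left by deck transformations, as
  \<open>join_class\<close>.\<close>

definition universal_cover :: "'m::topological_space \<Rightarrow> (real \<Rightarrow> 'm) set set" where
  "universal_cover x0 = {homotopy_class \<alpha> | \<alpha>. path \<alpha> \<and> pathstart \<alpha> = x0}"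

definition cover_proj :: "(real \<Rightarrow> 'm::topological_space) set \<Rightarrow> 'm" where
  "cover_proj m = pathfinish (SOME \<alpha>. \<alpha> \<in> m)"

text \<open>For \<open>V\<close> open and simply connected, the sheet over \<open>V\<close> through the class of \<open>\<alpha>\<close>; the projection
  maps it bijectively onto \<open>V\<close>.\<close>

definition sheet :: "(real \<Rightarrow> 'm::topological_space) \<Rightarrow> 'm set \<Rightarrow> (real \<Rightarrow> 'm) set set" where
  "sheet \<alpha> V =
     {homotopy_class (\<alpha> +++ \<beta>) | \<beta>. path \<beta> \<and> path_image \<beta> \<subseteq> V \<and> pathstart \<beta> = pathfinish \<alpha>}"

definition cover_atlas ::
    "('m::topological_space, 'e) atlas \<Rightarrow> 'm \<Rightarrow> ((real \<Rightarrow> 'm) set, 'e) atlas" where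
  "cover_atlas A x0 =
     {(sheet \<alpha> V, c \<circ> cover_proj) | \<alpha> U c V.
        (U, c) \<in> A \<and> V \<subseteq> U \<and> open V \<and> simply_connected V \<and>
        path \<alpha> \<and> pathstart \<alpha> = x0 \<and> pathfinish \<alpha> \<in> V}"

type_synonym 'm cover_times_Sol = "(real \<Rightarrow> 'm) set \<times> (real^3)"

text \<open>The total space of \<open>P\<^sub>\<rho>\<close> is the quotient of the universal cover times Sol by
  \<open>(m, g) \<sim> (\<gamma> m, \<rho>(\<gamma>) g)\<close>.\<close>

definition bundle_rel ::
    "'m::topological_space \<Rightarrow> ((real \<Rightarrow> 'm) set \<Rightarrow> real^3) \<Rightarrow> 'm cover_times_Sol rel" where
  "bundle_rel x0 \<rho> =
     {((m, g), (join_class \<gamma> m, \<rho> \<gamma> \<otimes>\<^bsub>Sol\<^esub> g)) | m g \<gamma>.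
        m \<in> universal_cover x0 \<and> \<gamma> \<in> carrier (pi1 x0)}"

definition flat_bundle ::
    "'m::topological_space \<Rightarrow> ((real \<Rightarrow> 'm) set \<Rightarrow> real^3) \<Rightarrow> 'm cover_times_Sol set set" where
  "flat_bundle x0 \<rho> = (universal_cover x0 \<times> UNIV) // bundle_rel x0 \<rho>"

definition bundle_proj :: "'m::topological_space cover_times_Sol set \<Rightarrow> 'm" where
  "bundle_proj p = cover_proj (fst (SOME r. r \<in> p))"

definition bundle_act ::
    "'m cover_times_Sol set \<Rightarrow> real^3 \<Rightarrow> 'm cover_times_Sol set" where
  "bundle_act p h = (\<lambda>(m, g). (m, g \<otimes>\<^bsub>Sol\<^esub> h)) ` p"

text \<open>The quotient map is injective on each (sheet times Sol), so its local inverses transport the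
  charts of the product to the quotient.\<close>

definition bundle_atlas ::
    "('m::topological_space, 'e::euclidean_space) atlas \<Rightarrow> 'm \<Rightarrow> ((real \<Rightarrow> 'm) set \<Rightarrow> real^3)
       \<Rightarrow> ('m cover_times_Sol set, 'e \<times> (real^3)) atlas" where
  "bundle_atlas A x0 \<rho> =
     (let q = (\<lambda>r. bundle_rel x0 \<rho> `` {r})
      in {(q ` W, \<phi> \<circ> inv_into W q) | W \<phi>.
            (W, \<phi>) \<in> product_atlas (cover_atlas A x0) model_atlas})"

definition bundle_section ::
    "('m::topological_space, 'e::euclidean_space) atlas \<Rightarrow> 'm \<Rightarrow> ((real \<Rightarrow> 'm) set \<Rightarrow> real^3)
       \<Rightarrow> ('m \<Rightarrow> 'm cover_times_Sol set) \<Rightarrow> bool" where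
  "bundle_section A x0 \<rho> s \<longleftrightarrow>
     smooth_map A (bundle_atlas A x0 \<rho>) s \<and> (\<forall>x. s x \<in> flat_bundle x0 \<rho> \<and> bundle_proj (s x) = x)"

section \<open>Connections and the relative Chern-Simons form\<close>

text \<open>The two last conditions are the reproduction of fundamental vector fields
  (\<open>\<xi>\<close> induces at \<open>p\<close> the image of \<open>\<xi>\<close> under the differential at the unit of the orbit map
  \<open>g \<mapsto> p g\<close>) and \<open>R\<^sub>g\<close>-equivariance.\<close>

definition connection_form ::
    "('m::topological_space, 'e::euclidean_space) atlas \<Rightarrow> 'm \<Rightarrow> ((real \<Rightarrow> 'm) set \<Rightarrow> real^3)
       \<Rightarrow> ('m cover_times_Sol set, 'e \<times> (real^3), real^3) form1 \<Rightarrow> bool" where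
  "connection_form A x0 \<rho> \<omega> \<longleftrightarrow>
     (let P = flat_bundle x0 \<rho>; B = bundle_atlas A x0 \<rho>
      in smooth_form1 B \<omega> \<and>
         (\<forall>p\<in>P. \<forall>\<xi>. \<omega> p (tangent_map model_atlas B (bundle_act p) \<one>\<^bsub>Sol\<^esub> \<xi>) = \<xi>) \<and>
         (\<forall>p\<in>P. \<forall>g v. pullback1 B B (\<lambda>q. bundle_act q g) \<omega> p v = sol_Ad (inv\<^bsub>Sol\<^esub> g) (\<omega> p v)))"

definition curvature ::
    "('p, 'f::euclidean_space) atlas \<Rightarrow> ('p, 'f, real^3) form1 \<Rightarrow> ('p, 'f, real^3) form2" where
  "curvature B \<omega> p u v = ext_deriv B \<omega> p u v + (1/2) *\<^sub>R wedge11 sol_bracket \<omega> \<omega> p u v"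

definition flat_connection ::
    "('m::topological_space, 'e::euclidean_space) atlas \<Rightarrow> 'm \<Rightarrow> ((real \<Rightarrow> 'm) set \<Rightarrow> real^3)
       \<Rightarrow> ('m cover_times_Sol set, 'e \<times> (real^3), real^3) form1 \<Rightarrow> bool" where
  "flat_connection A x0 \<rho> \<omega> \<longleftrightarrow>
     connection_form A x0 \<rho> \<omega> \<and>
     (\<forall>p\<in>flat_bundle x0 \<rho>. \<forall>u v. curvature (bundle_atlas A x0 \<rho>) \<omega> p u v = 0)"

text \<open>The characterising property of the trivial connection of a section \<open>s\<close>.\<close>

definition trivial_connection ::
    "('m::topological_space, 'e::euclidean_space) atlas \<Rightarrow> 'm \<Rightarrow> ((real \<Rightarrow> 'm) set \<Rightarrow> real^3)
       \<Rightarrow> ('m \<Rightarrow> 'm cover_times_Sol set)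
       \<Rightarrow> ('m cover_times_Sol set, 'e \<times> (real^3), real^3) form1 \<Rightarrow> bool" where
  "trivial_connection A x0 \<rho> s \<omega> \<longleftrightarrow>
     flat_connection A x0 \<rho> \<omega> \<and> (\<forall>x v. pullback1 A (bundle_atlas A x0 \<rho>) s \<omega> x v = 0)"

text \<open>The relative Chern-Simons form as a form on the total space. It is basic: the difference
  \<open>a\<close>, its covariant derivative and the curvature are horizontal and \<open>Ad\<close>-equivariant,
  i.e. they are the lifts of \<open>adP\<close>-valued forms on the base.\<close>

definition cs_total ::
    "('p, 'f::euclidean_space) atlas \<Rightarrow> (real^3 \<Rightarrow> real^3 \<Rightarrow> real)
       \<Rightarrow> ('p, 'f, real^3) form1 \<Rightarrow> ('p, 'f, real^3) form1 \<Rightarrow> ('p, 'f, real) form3" where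
  "cs_total B b \<omega>1 \<omega>0 p u v w =
     (let a = (\<lambda>p v. \<omega>1 p v - \<omega>0 p v);
          Da = (\<lambda>p u v. ext_deriv B a p u v + wedge11 sol_bracket \<omega>0 a p u v)
      in wedge12 b a Da p u v w
         + (1/3) * wedge12 b a (wedge11 sol_bracket a a) p u v w
         + 2 * wedge12 b a (curvature B \<omega>0) p u v w)"

text \<open>The form on the base is evaluated at any point of the fibre and any lifts of the tangent
  vectors; as \<^const>\<open>cs_total\<close> is basic, the choices do not matter.\<close>

definition relative_cs ::
    "('m::topological_space, 'e::euclidean_space) atlas \<Rightarrow> 'm \<Rightarrow> ((real \<Rightarrow> 'm) set \<Rightarrow> real^3)
       \<Rightarrow> (real^3 \<Rightarrow> real^3 \<Rightarrow> real)
       \<Rightarrow> ('m cover_times_Sol set, 'e \<times> (real^3), real^3) form1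
       \<Rightarrow> ('m cover_times_Sol set, 'e \<times> (real^3), real^3) form1 \<Rightarrow> ('m, 'e, real) form3" where
  "relative_cs A x0 \<rho> b \<omega>1 \<omega>0 x u v w =
     (let B = bundle_atlas A x0 \<rho>;
          p = (SOME p. p \<in> flat_bundle x0 \<rho> \<and> bundle_proj p = x);
          lift = (\<lambda>v. SOME v'. tangent_map B A bundle_proj p v' = v)
      in cs_total B b \<omega>1 \<omega>0 p (lift u) (lift v) (lift w))"

end

theory Submission
  imports Defs
begin

text \<open>The derived algebra of \<open>sol\<close> is spanned by \<open>X, Y\<close>, while \<open>p\<^sub>c\<close> sees only the
  \<open>Z\<close>-component. So the \<open>Z\<close>-component of a flat connection is closed, and \<open>CS\<close> reduces to
  \<open>c a\<^sub>3 \<and> da\<^sub>3\<close> with \<open>a\<^sub>3\<close> a difference of closed forms.\<close>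

text \<open>The charts of \<open>cover_atlas\<close> sit over simply connected open sets, so every
  point must have one inside a chart domain. The preimage of a coordinate ball works, being
  homeomorphic to a convex set.\<close>

lemma simply_connected_chart_nhd:
  assumes "smooth_atlas A"
  obtains U c V where "(U, c) \<in> A" "V \<subseteq> U" "open V" "simply_connected V" "x \<in> V"
proof -
  have "x \<in> atlas_carrier A"
    using assms by (simp add: smooth_atlas_def)
  then obtain U c where Uc: "(U, c) \<in> A" and x: "x \<in> U"
    unfolding atlas_carrier_def by blast
  have "\<forall>(U, c)\<in>A. open U \<and> open (c ` U) \<and> homeomorphism U (c ` U) c (inv_into U c)"
    using assms by (simp add: smooth_atlas_def)
  from bspec[OF this Uc] have "open U" and "open (c ` U)"
    and hom: "homeomorphism U (c ` U) c (inv_into U c)"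
    by simp_all
  from \<open>open (c ` U)\<close> x obtain e where "e > 0" and e: "ball (c x) e \<subseteq> c ` U"
    by (meson image_eqI openE)
  define V where "V = U \<inter> c -` ball (c x) e"
  have "c ` V = ball (c x) e"
    using e by (auto simp: V_def)
  moreover have "V \<subseteq> U"
    by (simp add: V_def)
  ultimately have "homeomorphism V (ball (c x) e) c (inv_into U c)"
    using e by (intro homeomorphism_of_subsets[OF hom]) auto
  then have "V homeomorphic ball (c x) e"
    unfolding homeomorphic_def by blast
  then have "simply_connected V"
    by (simp add: homeomorphic_simply_connected_eq convex_imp_simply_connected)
  moreover have "open V"
    unfolding V_def using \<open>open U\<close> hom
    by (intro continuous_open_preimage) (auto simp: homeomorphism_def)
  moreover have "x \<in> V"
    using x \<open>e > 0\<close> by (simp add: V_def)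
  ultimately show thesis
    using that Uc \<open>V \<subseteq> U\<close> by blast
qed

lemma homotopic_paths_join_const:
  fixes \<alpha> :: "real \<Rightarrow> 'a::topological_space"
  assumes "path \<alpha>"
  shows "homotopic_paths UNIV \<alpha> (\<alpha> +++ (\<lambda>_. pathfinish \<alpha>))"
\<comment> \<open>Running along \<alpha> at double speed and then waiting at its end point is
  \<alpha> composed with this function.\<close>
proof (rule homotopic_paths_reparametrize[where f = "\<lambda>t. min (2 * t) 1"])
  show "continuous_on {0..1} (\<lambda>t::real. min (2 * t) 1)"
    by (intro continuous_intros)
qed (use assms in \<open>auto simp: joinpaths_def pathfinish_def min_def\<close>)

lemma homotopy_class_eqI:
  assumes "homotopic_paths UNIV \<alpha> \<beta>"
  shows "homotopy_class \<alpha> = homotopy_class \<beta>"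
  unfolding homotopy_class_def
  using homotopic_paths_trans[OF assms] homotopic_paths_trans[OF homotopic_paths_sym[OF assms]]
  by (intro Collect_cong iffI)

text \<open>A sheet consists of classes of concatenations with paths in \<open>V\<close>; the
  constant path at the end point of \<alpha> gives back the class of \<alpha> itself.\<close>

lemma homotopy_class_in_sheet:
  assumes "path \<alpha>" and "pathfinish \<alpha> \<in> V"
  shows "homotopy_class \<alpha> \<in> sheet \<alpha> V"
proof -
  have "homotopy_class \<alpha> = homotopy_class (\<alpha> +++ (\<lambda>_. pathfinish \<alpha>))"
    by (intro homotopy_class_eqI homotopic_paths_join_const assms)
  moreover have "path (\<lambda>_::real. pathfinish \<alpha>)"
    by (simp add: path_def)
  ultimately show ?thesis
    using assms(2) unfolding sheet_def path_image_def pathstart_def by blast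
qed

text \<open>Flatness is stated at points of \<open>flat_bundle\<close>, smoothness of forms on the
  domains of bundle charts. This inclusion lets both be used at the same point: a representative of
  the point lies in some sheet times the whole group.\<close>

lemma flat_bundle_subset_bundle_atlas:
  assumes "smooth_atlas A"
  shows "flat_bundle x0 \<rho> \<subseteq> atlas_carrier (bundle_atlas A x0 \<rho>)"
proof
  fix p assume "p \<in> flat_bundle x0 \<rho>"
  then obtain \<alpha> g where \<alpha>: "path \<alpha>" "pathstart \<alpha> = x0"
    and p: "p = bundle_rel x0 \<rho> `` {(homotopy_class \<alpha>, g)}"
    unfolding flat_bundle_def quotient_def universal_cover_def by blast
  obtain U c V where V: "(U, c) \<in> A" "V \<subseteq> U" "open V" "simply_connected V" "pathfinish \<alpha> \<in> V"
    using simply_connected_chart_nhd[OF assms] .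
  let ?W = "sheet \<alpha> V \<times> (UNIV :: (real^3) set)"
  have "(sheet \<alpha> V, c \<circ> cover_proj) \<in> cover_atlas A x0"
    unfolding cover_atlas_def using V \<alpha> by blast
  then have "(?W, map_prod (c \<circ> cover_proj) id) \<in> product_atlas (cover_atlas A x0) model_atlas"
    unfolding product_atlas_def model_atlas_def by blast
  moreover have "(homotopy_class \<alpha>, g) \<in> ?W"
    using homotopy_class_in_sheet \<alpha> V by blast
  ultimately show "p \<in> atlas_carrier (bundle_atlas A x0 \<rho>)"
    unfolding atlas_carrier_def bundle_atlas_def Let_def p by blast
qed

lemma chart_at_mem:
  assumes "p \<in> atlas_carrier A"
  shows "chart_at A p \<in> A" and "p \<in> fst (chart_at A p)"
proof -
  have "\<exists>\<kappa>. \<kappa> \<in> A \<and> p \<in> fst \<kappa>"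
    using assms unfolding atlas_carrier_def by force
  then have "chart_at A p \<in> A \<and> p \<in> fst (chart_at A p)"
    unfolding chart_at_def by (rule someI_ex)
  then show "chart_at A p \<in> A" and "p \<in> fst (chart_at A p)" by auto
qed

lemma smooth_on_differentiable:
  assumes "smooth_on S f" and "x \<in> S"
  shows "f differentiable (at x)"
proof -
  have "Ck_on (Suc 0) S f"
    using assms(1) unfolding smooth_on_def by blast
  then show ?thesis
    using assms(2) by simp
qed

lemma chart_rep_differentiable:
  assumes "smooth_form1 A \<omega>" and "p \<in> atlas_carrier A"
  shows "(\<lambda>y. chart_rep A (chart_at A p) \<omega> y v) differentiable (at (snd (chart_at A p) p))"
proof -
  obtain U c where Uc: "chart_at A p = (U, c)" by fastforce
  with chart_at_mem[OF assms(2)] have "(U, c) \<in> A" "p \<in> U" by auto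
  with assms(1) show ?thesis
    unfolding smooth_form1_def Uc by (auto intro!: smooth_on_differentiable)
qed

lemma frechet_derivative_diff:
  assumes "f differentiable (at x)" and "g differentiable (at x)"
  shows "frechet_derivative (\<lambda>y. f y - g y) (at x) =
    (\<lambda>v. frechet_derivative f (at x) v - frechet_derivative g (at x) v)"
  using assms unfolding frechet_derivative_works
  by (intro frechet_derivative_at[symmetric] has_derivative_diff)

text \<open>Since \<open>frechet_derivative\<close> is a mere choice at points of
  non-differentiability, additivity of the exterior derivative rests on smoothness of both
  forms.\<close>

lemma ext_deriv_diff:
  assumes "smooth_form1 A \<alpha>" and "smooth_form1 A \<beta>" and "p \<in> atlas_carrier A"
  shows "ext_deriv A (\<lambda>p v. \<alpha> p v - \<beta> p v) p u v = ext_deriv A \<alpha> p u v - ext_deriv A \<beta> p u v"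
proof -
  \<comment> \<open>The pullback evaluates both forms at the same point on the same vector.\<close>
  have "chart_rep A \<kappa> (\<lambda>p v. \<alpha> p v - \<beta> p v) = (\<lambda>y v. chart_rep A \<kappa> \<alpha> y v - chart_rep A \<kappa> \<beta> y v)"
    for \<kappa>
    by (simp add: chart_rep_def pullback1_def fun_eq_iff)
  then show ?thesis
    using assms by (simp add: ext_deriv_def Let_def frechet_derivative_diff chart_rep_differentiable)
qed

lemma wedge11_sol_bracket_3: "wedge11 sol_bracket \<alpha> \<beta> p u v $ 3 = 0"
  by (simp add: wedge11_def sol_bracket_def)

lemma wedge12_sol_form_eq_0:
  assumes "\<And>u v. \<beta> p u v $ 3 = 0"
  shows "wedge12 (sol_form c) \<alpha> \<beta> p u v w = 0"
  by (simp add: wedge12_def sol_form_def assms)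

text \<open>Each of the three summands vanishes by itself, because its 2-form factor has no
  Z-component: for \<open>Da\<close> both the bracket term and the derivative of \<open>a\<close>
  lose it, for the bracket of \<open>a\<close> with itself it is absent, and the curvature of
  \<open>\<omega>0\<close> is zero.\<close>

lemma cs_total_eq_0:
  assumes "smooth_form1 B \<omega>1" and "smooth_form1 B \<omega>0" and "p \<in> atlas_carrier B"
    and "\<And>u v. curvature B \<omega>1 p u v = 0" and "\<And>u v. curvature B \<omega>0 p u v = 0"
  shows "cs_total B (sol_form c) \<omega>1 \<omega>0 p u v w = 0"
proof -
  have "curvature B \<omega> p u v $ 3 = ext_deriv B \<omega> p u v $ 3" for \<omega> u v
    by (simp add: curvature_def wedge11_sol_bracket_3)
  then have closed: "ext_deriv B \<omega> p u v $ 3 = 0" if "\<And>u v. curvature B \<omega> p u v = 0" for \<omega> u v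
    using that by (metis zero_index)
  show ?thesis
    unfolding cs_total_def Let_def
    by (simp add: wedge12_sol_form_eq_0 wedge11_sol_bracket_3 ext_deriv_diff closed assms)
qed

theorem proposition4p1:
  fixes A :: "('m::{t2_space, second_countable_topology}, real^3) atlas"
    and x0 :: 'm
    and \<rho> :: "(real \<Rightarrow> 'm) set \<Rightarrow> real^3"
    and s :: "'m \<Rightarrow> 'm cover_times_Sol set"
    and \<omega>_flat \<omega>_triv :: "('m cover_times_Sol set, (real^3) \<times> (real^3), real^3) form1"
    and c :: real
  assumes "smooth_atlas A" and "oriented_atlas A"
    and "compact (UNIV :: 'm set)" and "connected (UNIV :: 'm set)"
    and "\<rho> \<in> hom (pi1 x0) Sol"
    and "bundle_section A x0 \<rho> s"
    and "flat_connection A x0 \<rho> \<omega>_flat"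
    and "trivial_connection A x0 \<rho> s \<omega>_triv"
  shows "\<forall>x u v w. relative_cs A x0 \<rho> (sol_form c) \<omega>_flat \<omega>_triv x u v w = 0"
proof (intro allI)
  fix x u v w
  define p where "p = (SOME p. p \<in> flat_bundle x0 \<rho> \<and> bundle_proj p = x)"
  \<comment> \<open>The value of the section at \<open>x\<close> shows that the fibre is nonempty,
    so the choice made in \<open>relative_cs\<close> is a genuine point of the bundle.\<close>
  have "\<exists>p. p \<in> flat_bundle x0 \<rho> \<and> bundle_proj p = x"
    using assms(6) unfolding bundle_section_def by blast
  then have p: "p \<in> flat_bundle x0 \<rho>"
    unfolding p_def by (rule someI2_ex) blast
  have flat: "flat_connection A x0 \<rho> \<omega>_triv"
    using assms(8) by (simp add: trivial_connection_def)
  show "relative_cs A x0 \<rho> (sol_form c) \<omega>_flat \<omega>_triv x u v w = 0"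
    \<comment> \<open>At \<open>p\<close> the form \<open>cs_total\<close> vanishes on all triples
      of vectors, in particular on the chosen lifts.\<close>
    unfolding relative_cs_def Let_def p_def[symmetric]
    using assms(7) flat p flat_bundle_subset_bundle_atlas[OF assms(1)]
    by (intro cs_total_eq_0) (auto simp: flat_connection_def connection_form_def Let_def)
qed

end
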